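(* Let $X=\coprod_{\lambda\in\Lambda}G_\lambda$ be a multiple conjugation quandle and let $Y$ be an $X$-set. Then $P_*(X)_Y=(P_n(X)_Y,\partial_n)$ is a chain complex, i.e. $\partial_{n-1}\circ\partial_n=0$ for all $n$.
   Context: **MCQ.** A multiple conjugation quandle (MCQ) is a disjoint union $X=\coprod_{\lambda\in\Lambda}G_\lambda$ of groups with a binary operation $*:X\times X\to X$ such that: (1) $a*b=b^{-1}ab$ for $a,b\in G_\lambda$; (2) $x*e_\lambda=x$ and $x*(ab)=(x*a)*b$ for $x\in X$, $a,b\in G_\lambda$, where $e_\lambda$ is the identity of $G_\lambda$; (3) $(x*y)*z=(x*z)*(y*z)$ for $x,y,z\in X$; (4) for $x\in X$, $a,b\in G_\lambda$, the elements $a*x,b*x$ lie in a common group $G_\mu$ and $(ab)*x=(a*x)(b*x)$ in $G_\mu$. **$X$-set.** An $X$-set is a non-empty set $Y$ with a map $*:Y\times X\to Y$ such that $y*e_\lambda=y$ and $y*(ab)=(y*a)*b$ for $y\in Y$, $a,b\in G_\lambda$, and $(y*a)*b=(y*b)*(a*b)$ for $y\in Y$, $a,b\in X$. **Prismatic chains.** For $n\ge 0$, $P_n(X)_Y$ is the free abelian group generated by all tuples $(y;\boldsymbol a_1;\ldots;\boldsymbol a_k)$ with $y\in Y$, $k\ge 0$, where each $\boldsymbol a_i=(a_{i,1},\ldots,a_{i,n_i})$, $n_i\geq 1$, is a finite sequence of elements all lying in one and the same group $G_{\lambda_i}$ ($\lambda_i$ may vary with $i$), and $n_1+\cdots+n_k=n$.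 For $n<0$, $P_n(X)_Y=0$. The generator is written as a noncommutative product $\langle y\rangle\langle\boldsymbol a_1\rangle\cdots\langle\boldsymbol a_k\rangle$, and $|\langle y\rangle\langle\boldsymbol a_1\rangle\cdots\langle\boldsymbol a_k\rangle|:=n_1+\cdots+n_k$. For $b\in X$, $(\langle y\rangle\langle\boldsymbol a_1\rangle\cdots\langle\boldsymbol a_k\rangle)*b:=\langle y*b\rangle\langle\boldsymbol a_1*b\rangle\cdots\langle\boldsymbol a_k*b\rangle$, where $\boldsymbol a*b$ means applying $*b$ to each entry. **Boundary.** $\partial_n:P_n(X)_Y\to P_{n-1}(X)_Y$ is the homomorphism with $$\partial(\langle y\rangle\langle\boldsymbol a_1\rangle\cdots\langle\boldsymbol a_k\rangle)=\sum_{i=1}^k(-1)^{|\langle y\rangle\langle\boldsymbol a_1\rangle\cdots\langle\boldsymbol a_{i-1}\rangle|}\langle y\rangle\langle\boldsymbol a_1\rangle\cdots\partial\langle\boldsymbol a_i\rangle\cdots\langle\boldsymbol a_k\rangle,$$ $$\partial\langle a_1,\ldots,a_m\rangle=*a_1\langle a_2,\ldots,a_m\rangle+\sum_{i=1}^{m-1}(-1)^i\langle a_1,\ldots,a_ia_{i+1},\ldots,a_m\rangle+(-1)^m\langle a_1,\ldots,a_{m-1}\rangle.$$ Here the symbol $*a_1$ means that $*a_1$ is applied to the whole expression standing to its left (the $\langle y\rangle$ and all preceding factors), and an empty factor $\langle\ \rangle$ (occurring for $m=1$) is deleted. $\partial\langle y\rangle=0$. E.g. $\partial_2(\langle y\rangle\langle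 a\rangle\langle b\rangle)=\langle y*a\rangle\langle b\rangle-\langle y\rangle\langle b\rangle-\langle y*b\rangle\langle a*b\rangle+\langle y\rangle\langle a\rangle$. *)

theory Defs
  imports "HOL-Algebra.Free_Abelian_Groups" "HOL-Library.Disjoint_Sets"
begin

section \<open>Multiple conjugation quandles\<close>

definition mcq_carrier :: "'l set \<Rightarrow> ('l \<Rightarrow> ('x, 'm) monoid_scheme) \<Rightarrow> 'x set"
  where "mcq_carrier L G = (\<Union>l\<in>L. carrier (G l))"

locale multiple_conjugation_quandle =
  fixes L :: "'l set"
    and G :: "'l \<Rightarrow> ('x, 'm) monoid_scheme"
    and star :: "'x \<Rightarrow> 'x \<Rightarrow> 'x"  (infixl \<open>\<star>\<close> 70)
  assumes group: "l \<in> L \<Longrightarrow> group (G l)"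
    and disjoint: "disjoint_family_on (\<lambda>l. carrier (G l)) L"
    and star_closed: "\<lbrakk>x \<in> mcq_carrier L G; y \<in> mcq_carrier L G\<rbrakk> \<Longrightarrow> x \<star> y \<in> mcq_carrier L G"
    and star_conj: "\<lbrakk>l \<in> L; a \<in> carrier (G l); b \<in> carrier (G l)\<rbrakk>
      \<Longrightarrow> a \<star> b = inv\<^bsub>G l\<^esub> b \<otimes>\<^bsub>G l\<^esub> a \<otimes>\<^bsub>G l\<^esub> b"
    and star_one: "\<lbrakk>x \<in> mcq_carrier L G; l \<in> L\<rbrakk> \<Longrightarrow> x \<star> \<one>\<^bsub>G l\<^esub> = x"
    and star_mult: "\<lbrakk>x \<in> mcq_carrier L G; l \<in> L; a \<in> carrier (G l); b \<in> carrier (G l)\<rbrakk>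
      \<Longrightarrow> x \<star> (a \<otimes>\<^bsub>G l\<^esub> b) = (x \<star> a) \<star> b"
    and star_distrib: "\<lbrakk>x \<in> mcq_carrier L G; y \<in> mcq_carrier L G; z \<in> mcq_carrier L G\<rbrakk>
      \<Longrightarrow> (x \<star> y) \<star> z = (x \<star> z) \<star> (y \<star> z)"
    and mult_star: "\<lbrakk>x \<in> mcq_carrier L G; l \<in> L; a \<in> carrier (G l); b \<in> carrier (G l)\<rbrakk>
      \<Longrightarrow> \<exists>m\<in>L. a \<star> x \<in> carrier (G m) \<and> b \<star> x \<in> carrier (G m)
            \<and> (a \<otimes>\<^bsub>G l\<^esub> b) \<star> x = (a \<star> x) \<otimes>\<^bsub>G m\<^esub> (b \<star> x)"

locale mcq_set =
  fixes L :: "'l set"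
    and G :: "'l \<Rightarrow> ('x, 'm) monoid_scheme"
    and star :: "'x \<Rightarrow> 'x \<Rightarrow> 'x"  (infixl \<open>\<star>\<close> 70)
    and Y :: "'y set"
    and act :: "'y \<Rightarrow> 'x \<Rightarrow> 'y"  (infixl \<open>\<bullet>\<close> 70)
  assumes nonempty: "Y \<noteq> {}"
    and act_closed: "\<lbrakk>y \<in> Y; x \<in> mcq_carrier L G\<rbrakk> \<Longrightarrow> y \<bullet> x \<in> Y"
    and act_one: "\<lbrakk>y \<in> Y; l \<in> L\<rbrakk> \<Longrightarrow> y \<bullet> \<one>\<^bsub>G l\<^esub> = y"
    and act_mult: "\<lbrakk>y \<in> Y; l \<in> L; a \<in> carrier (G l); b \<in> carrier (G l)\<rbrakk>
      \<Longrightarrow> y \<bullet> (a \<otimes>\<^bsub>G l\<^esub> b) = (y \<bullet> a) \<bullet> b"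
    and act_distrib: "\<lbrakk>y \<in> Y; a \<in> mcq_carrier L G; b \<in> mcq_carrier L G\<rbrakk>
      \<Longrightarrow> (y \<bullet> a) \<bullet> b = (y \<bullet> b) \<bullet> (a \<star> b)"

text \<open>The product \<open>ab\<close> of two elements of a common group. As the carriers are disjoint,
  that group is determined by \<open>a\<close>.\<close>

definition mcq_mult :: "'l set \<Rightarrow> ('l \<Rightarrow> ('x, 'm) monoid_scheme) \<Rightarrow> 'x \<Rightarrow> 'x \<Rightarrow> 'x"
  where "mcq_mult L G a b = a \<otimes>\<^bsub>G (THE l. l \<in> L \<and> a \<in> carrier (G l))\<^esub> b"


section \<open>Prismatic chains\<close>

text \<open>The product \<open>\<langle>y\<rangle>\<langle>a\<^sub>1\<rangle>\<dots>\<langle>a\<^sub>k\<rangle>\<close> is represented by the pair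
  \<open>(y, [a\<^sub>1, \<dots>, a\<^sub>k])\<close>, where each block \<open>a\<^sub>i\<close> is itself a list.\<close>

type_synonym ('y, 'x) prism = "'y \<times> 'x list list"

definition prism_degree :: "('y, 'x) prism \<Rightarrow> nat"
  where "prism_degree p = sum_list (map length (snd p))"

definition prism_star ::
  "('x \<Rightarrow> 'x \<Rightarrow> 'x) \<Rightarrow> ('y \<Rightarrow> 'x \<Rightarrow> 'y) \<Rightarrow> ('y, 'x) prism \<Rightarrow> 'x \<Rightarrow> ('y, 'x) prism"
  where "prism_star star act p b = (act (fst p) b, map (map (\<lambda>a. star a b)) (snd p))"

definition prisms ::
  "'l set \<Rightarrow> ('l \<Rightarrow> ('x, 'm) monoid_scheme) \<Rightarrow> 'y set \<Rightarrow> int \<Rightarrow> ('y, 'x) prism set"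
  where "prisms L G Y n =
    {p. fst p \<in> Y
      \<and> (\<forall>a \<in> set (snd p). a \<noteq> [] \<and> (\<exists>l\<in>L. set a \<subseteq> carrier (G l)))
      \<and> int (prism_degree p) = n}"

text \<open>For \<open>n < 0\<close> there are no generators, so that this is the trivial group.\<close>

definition prismatic_chains ::
  "'l set \<Rightarrow> ('l \<Rightarrow> ('x, 'm) monoid_scheme) \<Rightarrow> 'y set \<Rightarrow> int \<Rightarrow> (('y, 'x) prism \<Rightarrow>\<^sub>0 int) monoid"
  where "prismatic_chains L G Y n = free_Abelian_group (prisms L G Y n)"


section \<open>Boundary\<close>

text \<open>The product of a left part \<open>p = \<langle>y\<rangle>\<langle>b\<^sub>1\<rangle>\<dots>\<langle>b\<^sub>j\<rangle>\<close>, a middle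
  factor \<open>\<langle>a\<rangle>\<close> and a right part \<open>\<langle>c\<^sub>1\<rangle>\<dots>\<langle>c\<^sub>k\<rangle>\<close>; an empty
  middle factor is deleted.\<close>

definition prism_join :: "('y, 'x) prism \<Rightarrow> 'x list \<Rightarrow> 'x list list \<Rightarrow> ('y, 'x) prism"
  where "prism_join p a cs = (fst p, snd p @ (if a = [] then [] else [a]) @ cs)"

text \<open>The index \<open>i\<close> counts from 1, so that \<open>a\<^sub>i\<close> is \<open>a ! (i - 1)\<close>.\<close>

definition merge_at :: "('x \<Rightarrow> 'x \<Rightarrow> 'x) \<Rightarrow> nat \<Rightarrow> 'x list \<Rightarrow> 'x list"
  where "merge_at mul i a = take (i - 1) a @ [mul (a ! (i - 1)) (a ! i)] @ drop (i + 1) a"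

text \<open>The expression \<open>p \<sqdot> \<partial>\<langle>a\<rangle> \<sqdot> \<langle>c\<^sub>1\<rangle>\<dots>\<langle>c\<^sub>k\<rangle>\<close>. The boundary of a
  block is only meaningful together with the part \<open>p\<close> to its left, on which its first entry acts.\<close>

definition block_boundary ::
  "'l set \<Rightarrow> ('l \<Rightarrow> ('x, 'm) monoid_scheme) \<Rightarrow> ('x \<Rightarrow> 'x \<Rightarrow> 'x) \<Rightarrow> ('y \<Rightarrow> 'x \<Rightarrow> 'y)
    \<Rightarrow> ('y, 'x) prism \<Rightarrow> 'x list \<Rightarrow> 'x list list \<Rightarrow> (('y, 'x) prism \<Rightarrow>\<^sub>0 int)"
  where "block_boundary L G star act p a cs =
      frag_of (prism_join (prism_star star act p (hd a)) (tl a) cs)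
    + (\<Sum>i = 1..<length a.
        frag_cmul ((-1) ^ i) (frag_of (prism_join p (merge_at (mcq_mult L G) i a) cs)))
    + frag_cmul ((-1) ^ length a) (frag_of (prism_join p (butlast a) cs))"

definition prism_boundary ::
  "'l set \<Rightarrow> ('l \<Rightarrow> ('x, 'm) monoid_scheme) \<Rightarrow> ('x \<Rightarrow> 'x \<Rightarrow> 'x) \<Rightarrow> ('y \<Rightarrow> 'x \<Rightarrow> 'y)
    \<Rightarrow> ('y, 'x) prism \<Rightarrow> (('y, 'x) prism \<Rightarrow>\<^sub>0 int)"
  where "prism_boundary L G star act p =
    (\<Sum>i<length (snd p).
      let q = (fst p, take i (snd p)) in
        frag_cmul ((-1) ^ prism_degree q)
          (block_boundary L G star act q (snd p ! i) (drop (Suc i) (snd p))))"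

definition prismatic_boundary ::
  "'l set \<Rightarrow> ('l \<Rightarrow> ('x, 'm) monoid_scheme) \<Rightarrow> ('x \<Rightarrow> 'x \<Rightarrow> 'x) \<Rightarrow> 'y set \<Rightarrow> ('y \<Rightarrow> 'x \<Rightarrow> 'y)
    \<Rightarrow> int \<Rightarrow> (('y, 'x) prism \<Rightarrow>\<^sub>0 int) \<Rightarrow> (('y, 'x) prism \<Rightarrow>\<^sub>0 int)"
  where "prismatic_boundary L G star Y act n =
    restrict (frag_extend (prism_boundary L G star act)) (carrier (prismatic_chains L G Y n))"


section \<open>Chain complexes\<close>

definition chain_complex :: "(int \<Rightarrow> ('c, 'm) monoid_scheme) \<Rightarrow> (int \<Rightarrow> 'c \<Rightarrow> 'c) \<Rightarrow> bool"
  where "chain_complex C d \<longleftrightarrow>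
    (\<forall>n. comm_group (C n) \<and> d n \<in> hom (C n) (C (n - 1))
       \<and> (\<forall>c \<in> carrier (C n). d (n - 1) (d n c) = \<one>\<^bsub>C (n - 2)\<^esub>))"

end

theory Submission
  imports Defs
begin

text \<open>Multiplying a prism \<open>p\<close> on the right by a block \<open>a\<close> gives
  \<open>\<partial>(p\<langle>a\<rangle>) = (\<partial>p)\<langle>a\<rangle> + (-1)\<^sup>|\<^sup>p\<^sup>| B\<^sub>a p\<close>, where \<open>B\<^sub>a p = p \<sqdot> \<partial>\<langle>a\<rangle>\<close> is the
  alternating sum of the terms \<open>(d\<^sub>i p)\<langle>d\<^sub>i a\<rangle>\<close> and \<open>d\<^sub>i\<close> are the face maps of the bar
  construction (\<open>d\<^sub>0\<close> lets \<open>a\<^sub>1\<close> act on \<open>p\<close>). By the simplicial identities the alternating sum of the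
  \<open>B\<close> applied to the faces vanishes, and \<open>\<partial>\<close> commutes with the quandle action, so \<open>\<partial>\<close> commutes with
  \<open>B\<^sub>a\<close>. As \<open>\<partial>\<close> lowers the degree by one, the two mixed terms of
  \<open>\<partial>\<partial>(p\<langle>a\<rangle>)\<close> cancel, and induction on the number of blocks concludes.\<close>

text \<open>Reduces an identity between additive maps on chains to generators, with no condition on
  the support.\<close>

lemma frag_induct [case_names zero one diff]:
  assumes "P 0" "\<And>x. P (frag_of x)" "\<And>a b. \<lbrakk>P a; P b\<rbrakk> \<Longrightarrow> P (a - b)"
  shows "P c"
  using frag_induction[of c UNIV P] assms by blast

lemma frag_cmul_diff_distrib2: "frag_cmul k (a - b) = frag_cmul k a - frag_cmul k b"
  by (simp add: right_diff_distrib lookup_minus poly_mapping_eqI)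

section \<open>Faces of a block\<close>

text \<open>The index \<open>i = 0\<close> drops the first entry, \<open>i = length a\<close> the last one, and other \<open>i\<close> merge
  entries \<open>i\<close> and \<open>i + 1\<close> (counted from 1).\<close>

definition face :: "('x \<Rightarrow> 'x \<Rightarrow> 'x) \<Rightarrow> nat \<Rightarrow> 'x list \<Rightarrow> 'x list"
  where "face mul i a =
    map (\<lambda>k. if Suc k < i then a ! k else if Suc k = i then mul (a ! k) (a ! Suc k) else a ! Suc k)
      [0..<length a - 1]"

text \<open>Paired with \<open>face\<close>, this gives all terms of a block boundary one shape, so
  the outer faces need no separate treatment.\<close>

definition left_face ::
  "('x \<Rightarrow> 'x \<Rightarrow> 'x) \<Rightarrow> ('y \<Rightarrow> 'x \<Rightarrow> 'y) \<Rightarrow> nat \<Rightarrow> ('y, 'x) prism \<Rightarrow> 'x list \<Rightarrow> ('y, 'x) prism"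
  where "left_face star act i p a = (if i = 0 then prism_star star act p (hd a) else p)"

lemma length_face [simp]: "length (face mul i a) = length a - 1"
  by (simp add: face_def)

lemma face_eq_Nil_iff: "face mul i a = [] \<longleftrightarrow> length a \<le> 1"
  by (simp add: face_def)

lemma face_nth: "k < length a - 1 \<Longrightarrow> face mul i a ! k =
    (if Suc k < i then a ! k else if Suc k = i then mul (a ! k) (a ! Suc k) else a ! Suc k)"
  by (simp add: face_def)

lemma face_0: "face mul 0 a = tl a"
  by (rule nth_equalityI) (simp_all add: face_nth nth_tl)

lemma face_length: "face mul (length a) a = butlast a"
  by (rule nth_equalityI) (auto simp add: face_nth nth_butlast)

lemma face_merge_at:
  assumes "1 \<le> i" "i < length a"
  shows "face mul i a = merge_at mul i a"
proof (rule nth_equalityI)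
  show "length (face mul i a) = length (merge_at mul i a)"
    using assms by (simp add: merge_at_def)
next
  fix k assume k: "k < length (face mul i a)"
  consider "Suc k < i" | "Suc k = i" | "Suc k > i" by linarith
  then show "face mul i a ! k = merge_at mul i a ! k"
  proof cases
    case 3
    \<comment> \<open>Position \<open>k\<close> lies in the part \<open>drop (i + 1) a\<close>, at
      offset \<open>k - i\<close>, so its entry is \<open>a ! Suc k\<close>.\<close>
    then have "Suc k - i = Suc (k - i)" "i + (k - i) = k" by auto
    with 3 k assms show ?thesis
      by (auto simp: face_nth merge_at_def nth_append min_def)
  qed (use k assms in \<open>auto simp: face_nth merge_at_def nth_append min_def\<close>)
qed

lemma face_map:
  assumes "\<And>x y. x \<in> set a \<Longrightarrow> y \<in> set a \<Longrightarrow> f (mul x y) = mul' (f x) (f y)"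
  shows "map f (face mul i a) = face mul' i (map f a)"
  using assms by (intro nth_equalityI) (auto simp: face_nth)

text \<open>The simplicial identity. Associativity enters only for \<open>j = i + 1\<close> with
  both faces merging, when three consecutive entries become one.\<close>

lemma face_face:
  assumes "\<And>x y z. \<lbrakk>x \<in> set a; y \<in> set a; z \<in> set a\<rbrakk> \<Longrightarrow> mul (mul x y) z = mul x (mul y z)"
    and "i < j" "j \<le> length a"
  shows "face mul i (face mul j a) = face mul (j - 1) (face mul i a)"
  using assms by (intro nth_equalityI) (auto simp: face_nth)

lemma set_face:
  assumes "\<And>x y. x \<in> A \<Longrightarrow> y \<in> A \<Longrightarrow> mul x y \<in> A" "set a \<subseteq> A"
  shows "set (face mul i a) \<subseteq> A"
proof -
  have "a ! k \<in> A" if "k < length a" for k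
    using that assms(2) nth_mem by blast
  then show ?thesis
    using assms(1) by (auto simp: face_def)
qed

lemma block_boundary_eq_faces:
  assumes "a \<noteq> []"
  shows "block_boundary L G star act p a cs =
    (\<Sum>i\<le>length a. frag_cmul ((-1) ^ i)
      (frag_of (prism_join (left_face star act i p a) (face (mcq_mult L G) i a) cs)))"
    (is "_ = (\<Sum>i\<le>length a. ?t i)")
proof -
  \<comment> \<open>Nonemptiness keeps the two outer indices distinct.\<close>
  have "{..length a} = insert 0 (insert (length a) {1..<length a})"
    using assms by auto
  then have "(\<Sum>i\<le>length a. ?t i) = ?t 0 + (?t (length a) + (\<Sum>i=1..<length a. ?t i))"
    using assms by simp
  moreover have "(\<Sum>i=1..<length a. ?t i) = (\<Sum>i = 1..<length a.
        frag_cmul ((-1) ^ i) (frag_of (prism_join p (merge_at (mcq_mult L G) i a) cs)))"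
    by (intro sum.cong) (auto simp: face_merge_at left_face_def)
  ultimately show ?thesis
    using assms by (simp add: block_boundary_def face_0 face_length left_face_def ac_simps)
qed

section \<open>Right multiplication and the recursion for the boundary\<close>

definition right_mult :: "'x list \<Rightarrow> (('y, 'x) prism \<Rightarrow>\<^sub>0 int) \<Rightarrow> (('y, 'x) prism \<Rightarrow>\<^sub>0 int)"
  where "right_mult a = frag_extend (\<lambda>p. frag_of (prism_join p a []))"

lemma prism_degree_join: "prism_degree (prism_join p a cs) =
    prism_degree p + length a + sum_list (map length cs)"
  by (simp add: prism_degree_def prism_join_def)

lemma prism_degree_star [simp]: "prism_degree (prism_star star act p b) = prism_degree p"
  by (simp add: prism_degree_def prism_star_def comp_def)

lemma right_mult_cmul: "right_mult a (frag_cmul k c) = frag_cmul k (right_mult a c)"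
  by (simp add: right_mult_def frag_extend_cmul)

lemma right_mult_sum: "finite I \<Longrightarrow> right_mult a (\<Sum>i\<in>I. f i) = (\<Sum>i\<in>I. right_mult a (f i))"
  by (simp add: right_mult_def frag_extend_sum comp_def)

lemma right_mult_of [simp]: "right_mult a (frag_of p) = frag_of (prism_join p a [])"
  by (simp add: right_mult_def)

text \<open>Faces change only the block and what stands to its left, so a further right factor is
  merely carried along.\<close>

lemma right_mult_block_boundary:
  assumes "b \<noteq> []" "a \<noteq> []"
  shows "right_mult b (block_boundary L G star act p a cs)
    = block_boundary L G star act p a (cs @ [b])"
  using assms
  by (simp add: block_boundary_eq_faces right_mult_sum right_mult_cmul) (simp add: prism_join_def)

text \<open>For the empty block, \<open>block_boundary\<close> is a junk value involving \<open>hd []\<close>; the value 0 makes the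
  recursion for the boundary hold also when the only entry of a last block is deleted.\<close>

definition last_boundary ::
  "'l set \<Rightarrow> ('l \<Rightarrow> ('x, 'm) monoid_scheme) \<Rightarrow> ('x \<Rightarrow> 'x \<Rightarrow> 'x) \<Rightarrow> ('y \<Rightarrow> 'x \<Rightarrow> 'y)
    \<Rightarrow> ('y, 'x) prism \<Rightarrow> 'x list \<Rightarrow> (('y, 'x) prism \<Rightarrow>\<^sub>0 int)"
  where "last_boundary L G star act p a =
    (if a = [] then 0 else block_boundary L G star act p a [])"

lemma prism_boundary_Nil [simp]: "prism_boundary L G star act (y, []) = 0"
  by (simp add: prism_boundary_def)

text \<open>The last summand of the boundary is split off; in all others \<open>a\<close> is a right
  factor. For \<open>a = []\<close> right multiplication is the identity, as
  \<open>prism_join\<close> deletes empty factors.\<close>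

lemma prism_boundary_join:
  assumes "\<And>b. b \<in> set (snd p) \<Longrightarrow> b \<noteq> []"
  shows "prism_boundary L G star act (prism_join p a []) =
    right_mult a (prism_boundary L G star act p)
    + frag_cmul ((-1) ^ prism_degree p) (last_boundary L G star act p a)"
proof (cases "a = []")
  case True
  have "right_mult [] c = c" for c :: "('b, 'a) prism \<Rightarrow>\<^sub>0 int"
    by (induction c rule: frag_induct)
      (simp_all add: right_mult_def frag_extend_diff prism_join_def)
  with True show ?thesis
    by (simp add: last_boundary_def prism_join_def)
next
  case False
  obtain y as where p: "p = (y, as)" by force
  have "as ! i \<noteq> []" if "i < length as" for i
    using that assms p by simp
  then show ?thesis
    using False
    by (simp add: p prism_join_def prism_boundary_def Let_def last_boundary_def right_mult_sum
        right_mult_cmul right_mult_block_boundary nth_append)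
qed

text \<open>The terms at \<open>(j, i)\<close> with \<open>i < j\<close> are matched with those at
  \<open>(i, j - 1)\<close>, which fill the rest of the rectangle. Values agree and the exponents
  differ by one, so the pairs cancel.\<close>

lemma alternating_double_sum_eq_0:
  fixes h :: "nat \<Rightarrow> nat \<Rightarrow> ('a \<Rightarrow>\<^sub>0 int)"
  assumes "\<And>i j. i < j \<Longrightarrow> j \<le> Suc m \<Longrightarrow> h j i = h i (j - 1)"
  shows "(\<Sum>j\<le>Suc m. \<Sum>i\<le>m. frag_cmul ((-1) ^ (i + j)) (h j i)) = 0"
proof -
  let ?t = "\<lambda>(j, i). frag_cmul ((-1) ^ (i + j)) (h j i)"
  let ?A = "{(j, i). i < j \<and> j \<le> Suc m}" and ?B = "{(j, i). j \<le> i \<and> i \<le> m}"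
  have fin: "finite ?A" "finite ?B"
    by (rule finite_subset[of _ "{..Suc m} \<times> {..Suc m}"]; auto)+
  have "(\<Sum>j\<le>Suc m. \<Sum>i\<le>m. frag_cmul ((-1) ^ (i + j)) (h j i)) = sum ?t ({..Suc m} \<times> {..m})"
    by (simp add: sum.cartesian_product)
  also have "{..Suc m} \<times> {..m} = ?A \<union> ?B" by auto
  also have "sum ?t (?A \<union> ?B) = sum ?t ?A + sum ?t ?B"
    by (rule sum.union_disjoint[OF fin]) auto
  also have "sum ?t ?A = (\<Sum>x\<in>?B. - ?t x)"
  proof (rule sum.reindex_bij_witness[where i = "\<lambda>(j, i). (Suc i, j)" and j = "\<lambda>(j, i). (i, j - 1)"])
    fix x assume "x \<in> ?A"
    then obtain j i where x: "x = (Suc j, i)" "i \<le> j" "j \<le> m"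
      by (cases x; cases "fst x") auto
    then show "- ?t ((\<lambda>(j, i). (i, j - 1)) x) = ?t x"
      using assms[of i "Suc j"] by (simp add: add.commute)
  qed auto
  finally show ?thesis by (simp add: sum_negf)
qed

section \<open>Quandle action and face identities on prisms\<close>

locale prismatic = multiple_conjugation_quandle L G star + mcq_set L G star Y act
  for L :: "'l set" and G :: "'l \<Rightarrow> ('x, 'm) monoid_scheme"
    and star :: "'x \<Rightarrow> 'x \<Rightarrow> 'x" and Y :: "'y set" and act :: "'y \<Rightarrow> 'x \<Rightarrow> 'y"
begin

abbreviation "X \<equiv> mcq_carrier L G"
abbreviation "mul \<equiv> mcq_mult L G"
abbreviation "pstar \<equiv> prism_star star act"
abbreviation "bd \<equiv> prism_boundary L G star act"

lemma carrier_subset: "l \<in> L \<Longrightarrow> carrier (G l) \<subseteq> X"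
  by (auto simp: mcq_carrier_def)

lemma same_group: "\<lbrakk>l \<in> L; m \<in> L; x \<in> carrier (G l); x \<in> carrier (G m)\<rbrakk> \<Longrightarrow> l = m"
  using disjoint by (auto simp: disjoint_family_on_def)

lemma mul_eq: "\<lbrakk>l \<in> L; a \<in> carrier (G l)\<rbrakk> \<Longrightarrow> mul a b = a \<otimes>\<^bsub>G l\<^esub> b"
  unfolding mcq_mult_def by (rule arg_cong[of _ _ "\<lambda>l. a \<otimes>\<^bsub>G l\<^esub> b"])
    (auto intro!: the_equality same_group)

lemma mul_closed: "\<lbrakk>l \<in> L; a \<in> carrier (G l); b \<in> carrier (G l)\<rbrakk> \<Longrightarrow> mul a b \<in> carrier (G l)"
  by (simp add: mul_eq group group.is_monoid monoid.m_closed)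

lemma mul_assoc: "\<lbrakk>l \<in> L; a \<in> carrier (G l); b \<in> carrier (G l); c \<in> carrier (G l)\<rbrakk>
    \<Longrightarrow> mul (mul a b) c = mul a (mul b c)"
  by (metis group group.is_monoid monoid.m_assoc mul_closed mul_eq)

lemma mul_star: "\<lbrakk>x \<in> X; l \<in> L; a \<in> carrier (G l); b \<in> carrier (G l)\<rbrakk>
    \<Longrightarrow> star (mul a b) x = mul (star a x) (star b x)"
  using mult_star[of x l a b] by (auto simp: mul_eq)

text \<open>The axiom places only two images at a time in a common group. Comparing each entry with
  the first one and using disjointness yields a single group for the block.\<close>

lemma star_block:
  assumes "x \<in> X" "l \<in> L" "set a \<subseteq> carrier (G l)"
  shows "\<exists>m\<in>L. set (map (\<lambda>u. star u x) a) \<subseteq> carrier (G m)"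
proof (cases a)
  case Nil
  with assms(2) show ?thesis by auto
next
  case (Cons u us)
  then have "u \<in> carrier (G l)" using assms(3) by simp
  then obtain m where m: "m \<in> L" "star u x \<in> carrier (G m)"
    using mult_star[OF assms(1,2)] by blast
  have "star v x \<in> carrier (G m)" if "v \<in> set a" for v
    using mult_star[OF assms(1,2), of u v] \<open>u \<in> carrier (G l)\<close> that assms(3) m same_group
    by blast
  with m show ?thesis by auto
qed

text \<open>Leaves the degree open, since it varies along the induction over blocks.\<close>

definition proper :: "('y, 'x) prism \<Rightarrow> bool"
  where "proper p \<longleftrightarrow> fst p \<in> Y \<and> (\<forall>a\<in>set (snd p). a \<noteq> [] \<and> (\<exists>l\<in>L. set a \<subseteq> carrier (G l)))"

lemma prisms_eq: "prisms L G Y n = {p. proper p \<and> int (prism_degree p) = n}"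
  by (auto simp: prisms_def proper_def)

lemma proper_entry: "\<lbrakk>proper p; c \<in> set (snd p); x \<in> set c\<rbrakk> \<Longrightarrow> x \<in> X"
  unfolding proper_def mcq_carrier_def by blast

lemma bd_join: "proper p \<Longrightarrow> bd (prism_join p a []) =
    right_mult a (bd p) + frag_cmul ((-1) ^ prism_degree p) (last_boundary L G star act p a)"
  by (rule prism_boundary_join) (simp add: proper_def)

text \<open>Blocks are added on the right because the boundary recursion splits off the last
  block.\<close>

lemma proper_induct [consumes 1, case_names Nil join]:
  assumes "proper p"
    and "\<And>y. y \<in> Y \<Longrightarrow> P (y, [])"
    and "\<And>p l a. \<lbrakk>proper p; a \<noteq> []; l \<in> L; set a \<subseteq> carrier (G l); P p\<rbrakk> \<Longrightarrow> P (prism_join p a [])"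
  shows "P p"
proof -
  obtain y as where p: "p = (y, as)" by force
  have "proper (y, as) \<Longrightarrow> P (y, as)"
  proof (induction as rule: rev_induct)
    case Nil
    then show ?case using assms(2) by (simp add: proper_def)
  next
    case (snoc a as)
    then have "proper (y, as)" "a \<noteq> []" "\<exists>l\<in>L. set a \<subseteq> carrier (G l)"
      by (auto simp: proper_def)
    then have "P (prism_join (y, as) a [])"
      using snoc.IH assms(3) by blast
    with \<open>a \<noteq> []\<close> show ?case by (simp add: prism_join_def)
  qed
  with assms(1) p show ?thesis by simp
qed

lemma proper_star: "\<lbrakk>proper p; b \<in> X\<rbrakk> \<Longrightarrow> proper (pstar p b)"
  using star_block by (fastforce simp: proper_def prism_star_def act_closed)

lemma proper_join: "\<lbrakk>proper p; l \<in> L; set a \<subseteq> carrier (G l)\<rbrakk> \<Longrightarrow> proper (prism_join p a [])"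
  by (auto simp: proper_def prism_join_def)

lemma proper_left_face:
  "\<lbrakk>proper p; l \<in> L; set a \<subseteq> carrier (G l); a \<noteq> []\<rbrakk> \<Longrightarrow> proper (left_face star act i p a)"
  using carrier_subset[of l] hd_in_set[of a] by (simp add: left_face_def proper_star subset_iff)

lemma pstar_mul:
  assumes "proper p" "l \<in> L" "a \<in> carrier (G l)" "b \<in> carrier (G l)"
  shows "pstar p (mul a b) = pstar (pstar p a) b"
proof -
  have "star x (mul a b) = star (star x a) b" if "c \<in> set (snd p)" "x \<in> set c" for c x
    using that assms proper_entry[of p] by (simp add: mul_eq star_mult)
  with assms show ?thesis
    by (auto simp: prism_star_def mul_eq act_mult proper_def)
qed

lemma pstar_distrib:
  assumes "proper p" "a \<in> X" "b \<in> X"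
  shows "pstar (pstar p a) b = pstar (pstar p b) (star a b)"
proof -
  have "star (star x a) b = star (star x b) (star a b)" if "c \<in> set (snd p)" "x \<in> set c" for c x
    using that assms proper_entry by (intro star_distrib) auto
  with assms show ?thesis
    by (auto simp: prism_star_def act_distrib proper_def)
qed

text \<open>Only \<open>i = 0\<close> is of interest. For \<open>j = 1\<close>, acting by the
  product of the first two entries is acting by one after the other; for larger \<open>j\<close> the
  head of the block is unchanged.\<close>

lemma left_face_face:
  assumes "proper p" "l \<in> L" "set a \<subseteq> carrier (G l)" "2 \<le> length a" "i < j" "j \<le> length a"
  shows "left_face star act i (left_face star act j p a) (face mul j a)
    = left_face star act (j - 1) (left_face star act i p a) (face mul i a)"
proof -
  have "a ! 0 \<in> carrier (G l)" "a ! 1 \<in> carrier (G l)"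
    using assms(3,4) by (auto intro!: subsetD[OF assms(3)] nth_mem)
  moreover have "a \<noteq> []" "face mul k a \<noteq> []" for k
    using assms(4) by (auto simp: face_eq_Nil_iff)
  ultimately show ?thesis
    using assms by (auto simp: left_face_def hd_conv_nth face_nth pstar_mul)
qed

lemma last_boundary_faces_eq_0:
  assumes "proper p" "l \<in> L" "set a \<subseteq> carrier (G l)"
  shows "(\<Sum>j\<le>length a. frag_cmul ((-1) ^ j)
    (last_boundary L G star act (left_face star act j p a) (face mul j a))) = 0"
proof (cases "length a \<le> 1")
  case True
  \<comment> \<open>All faces are empty here, and \<open>last_boundary\<close> is 0 on them.\<close>
  then show ?thesis by (simp add: last_boundary_def face_eq_Nil_iff)
next
  case False
  then obtain m where m: "length a = Suc m" "1 \<le> m" by (cases "length a") auto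
  let ?h = "\<lambda>j i. frag_of (prism_join (left_face star act i (left_face star act j p a) (face mul j a))
      (face mul i (face mul j a)) [])"
  have "(\<Sum>j\<le>Suc m. \<Sum>i\<le>m. frag_cmul ((-1) ^ (i + j)) (?h j i)) = 0"
  proof (rule alternating_double_sum_eq_0)
    fix i j assume ij: "i < j" "j \<le> Suc m"
    have "face mul i (face mul j a) = face mul (j - 1) (face mul i a)"
      by (rule face_face) (use ij m assms in \<open>auto intro!: mul_assoc[of l]\<close>)
    moreover have "left_face star act i (left_face star act j p a) (face mul j a)
      = left_face star act (j - 1) (left_face star act i p a) (face mul i a)"
      by (rule left_face_face) (use ij m assms in auto)
    ultimately show "?h j i = ?h i (j - 1)" by simp
  qed
  moreover have "face mul j a \<noteq> []" for j
    using m by (simp add: face_eq_Nil_iff)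
  ultimately show ?thesis
    using m
    by (simp add: last_boundary_def block_boundary_eq_faces frag_cmul_sum power_add mult.commute del: sum.atMost_Suc)
qed

section \<open>Compatibility of the boundary with the action\<close>

text \<open>Merging faces commute with the action because it is multiplicative on each group, the
  zeroth face by distributivity.\<close>

lemma pstar_block_boundary:
  assumes "proper p" "l \<in> L" "set a \<subseteq> carrier (G l)" "a \<noteq> []" "b \<in> X"
  shows "frag_extend (\<lambda>q. frag_of (pstar q b)) (block_boundary L G star act p a [])
    = block_boundary L G star act (pstar p b) (map (\<lambda>x. star x b) a) []"
proof -
  have "hd a \<in> X" using assms carrier_subset hd_in_set by blast
  have "pstar (prism_join (left_face star act i p a) (face mul i a) []) b
    = prism_join (left_face star act i (pstar p b) (map (\<lambda>x. star x b) a))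
        (face mul i (map (\<lambda>x. star x b) a)) []" for i
  proof -
    have "map (\<lambda>x. star x b) (face mul i a) = face mul i (map (\<lambda>x. star x b) a)"
      using assms by (intro face_map mul_star) auto
    moreover have "pstar (left_face star act i p a) b
        = left_face star act i (pstar p b) (map (\<lambda>x. star x b) a)"
      using assms \<open>hd a \<in> X\<close> by (auto simp: left_face_def hd_map intro: pstar_distrib)
    moreover have "pstar (prism_join q c []) b = prism_join (pstar q b) (map (\<lambda>x. star x b) c) []" for q c
      by (simp add: prism_star_def prism_join_def)
    ultimately show ?thesis by simp
  qed
  with assms(4) show ?thesis
    by (simp add: block_boundary_eq_faces frag_extend_sum frag_extend_cmul comp_def)
qed

text \<open>Needed for the zeroth face of a block, which acts on the prism to its left.\<close>

lemma bd_pstar: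
  assumes "proper p" "b \<in> X"
  shows "bd (pstar p b) = frag_extend (\<lambda>q. frag_of (pstar q b)) (bd p)"
  using assms(1)
proof (induction rule: proper_induct)
  case (Nil y)
  then show ?case by (simp add: prism_star_def)
next
  case (join p l a)
  let ?S = "frag_extend (\<lambda>q. frag_of (pstar q b))" and ?a = "map (\<lambda>x. star x b) a"
  have star_join: "pstar (prism_join q a []) b = prism_join (pstar q b) ?a []" for q
    by (simp add: prism_star_def prism_join_def)
  have "?S (right_mult a c) = right_mult ?a (?S c)" for c
    by (induction c rule: frag_induct)
      (simp_all add: right_mult_def frag_extend_diff star_join)
  then show ?case
    using join assms(2) proper_star[OF join(1) assms(2)]
    by (simp add: star_join bd_join frag_extend_add frag_extend_cmul
        last_boundary_def pstar_block_boundary)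
qed

section \<open>Supports and degrees\<close>

lemma keys_block_boundary:
  assumes "proper p" "l \<in> L" "set a \<subseteq> carrier (G l)" "a \<noteq> []"
    and "q \<in> Poly_Mapping.keys (block_boundary L G star act p a [])"
  shows "proper q \<and> Suc (prism_degree q) = prism_degree p + length a"
proof -
  have "\<exists>i. q = prism_join (left_face star act i p a) (face mul i a) []"
    using assms(4,5) unfolding block_boundary_eq_faces[OF assms(4)]
    by (auto dest!: subsetD[OF keys_sum] subsetD[OF keys_cmul])
  then obtain i where q: "q = prism_join (left_face star act i p a) (face mul i a) []" ..
  have "proper q"
    unfolding q using assms by (intro proper_join proper_left_face set_face mul_closed) auto
  moreover have "Suc (prism_degree q) = prism_degree p + length a"
    using assms(4) by (cases a) (simp_all add: q prism_degree_join left_face_def)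
  ultimately show ?thesis ..
qed

text \<open>Yields both the target group of the boundary and the sign change behind the final
  cancellation.\<close>

lemma keys_bd:
  assumes "proper p" "q \<in> Poly_Mapping.keys (bd p)"
  shows "proper q \<and> Suc (prism_degree q) = prism_degree p"
  using assms
proof (induction arbitrary: q rule: proper_induct)
  case (Nil y)
  then show ?case by simp
next
  case (join p l a)
  have "q \<in> Poly_Mapping.keys (right_mult a (bd p))
      \<or> q \<in> Poly_Mapping.keys (block_boundary L G star act p a [])"
    using join.prems join.hyps
    by (auto simp: bd_join last_boundary_def dest!: subsetD[OF keys_add])
  then show ?case
  proof
    assume "q \<in> Poly_Mapping.keys (right_mult a (bd p))"
    then obtain r where "r \<in> Poly_Mapping.keys (bd p)" "q = prism_join r a []"
      unfolding right_mult_def using keys_frag_extend by fastforce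
    then show ?thesis
      using join.IH join.hyps by (fastforce simp: prism_degree_join intro: proper_join)
  qed (use join.hyps keys_block_boundary in \<open>simp add: prism_degree_join\<close>)
qed

section \<open>The boundary squares to zero\<close>

lemma bd_block_boundary:
  assumes "proper p" "l \<in> L" "set a \<subseteq> carrier (G l)" "a \<noteq> []"
  shows "frag_extend bd (block_boundary L G star act p a [])
    = frag_extend (\<lambda>q. block_boundary L G star act q a []) (bd p)"
proof -
  let ?F = "\<lambda>j. frag_extend (\<lambda>q. frag_of (left_face star act j q a))"
  have hd: "hd a \<in> X" using assms carrier_subset hd_in_set by blast
  \<comment> \<open>For \<open>j = 0\<close> this is \<open>bd_pstar\<close>; for other
    \<open>j\<close> the map \<open>?F j\<close> is the identity.\<close>
  have F: "bd (left_face star act j p a) = ?F j (bd p)" for j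
    using bd_pstar[OF assms(1) hd] by (simp add: left_face_def flip: frag_expansion)
  have "frag_extend bd (block_boundary L G star act p a [])
    = (\<Sum>j\<le>length a. frag_cmul ((-1) ^ j)
         (bd (prism_join (left_face star act j p a) (face mul j a) [])))"
    using assms(4) by (simp add: block_boundary_eq_faces frag_extend_sum frag_extend_cmul comp_def)
  also have "\<dots> = (\<Sum>j\<le>length a. frag_cmul ((-1) ^ j) (right_mult (face mul j a) (?F j (bd p)))
      + frag_cmul ((-1) ^ prism_degree p) (frag_cmul ((-1) ^ j)
          (last_boundary L G star act (left_face star act j p a) (face mul j a))))"
  proof (rule sum.cong[OF refl])
    fix j
    \<comment> \<open>The action preserves degrees, so the sign is the same for all \<open>j\<close>
      and can be factored out of the sum.\<close>
    have "prism_degree (left_face star act j p a) = prism_degree p"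
      by (simp add: left_face_def)
    then show "frag_cmul ((-1) ^ j) (bd (prism_join (left_face star act j p a) (face mul j a) []))
      = frag_cmul ((-1) ^ j) (right_mult (face mul j a) (?F j (bd p)))
      + frag_cmul ((-1) ^ prism_degree p) (frag_cmul ((-1) ^ j)
          (last_boundary L G star act (left_face star act j p a) (face mul j a)))"
      using proper_left_face[OF assms]
      by (simp add: bd_join F frag_cmul_distrib2 mult.commute)
  qed
  also have "\<dots> = (\<Sum>j\<le>length a. frag_cmul ((-1) ^ j) (right_mult (face mul j a) (?F j (bd p))))"
    using last_boundary_faces_eq_0[OF assms(1-3)]
    by (simp add: sum.distrib del: frag_cmul_cmul flip: frag_cmul_sum)
  also have "\<dots> = frag_extend (\<lambda>q. block_boundary L G star act q a []) (bd p)"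
  proof -
    \<comment> \<open>Both sides are additive in \<open>c\<close>; on a generator this is the
      expansion of the block boundary into faces.\<close>
    have "(\<Sum>j\<le>length a. frag_cmul ((-1) ^ j) (right_mult (face mul j a) (?F j c)))
      = frag_extend (\<lambda>q. block_boundary L G star act q a []) c" for c
      by (induction c rule: frag_induct)
        (simp_all add: right_mult_def block_boundary_eq_faces[OF assms(4)] frag_extend_diff
          frag_cmul_diff_distrib2 sum_subtractf)
    then show ?thesis by simp
  qed
  finally show ?thesis .
qed

lemma bd_bd: "proper p \<Longrightarrow> frag_extend bd (bd p) = 0"
proof (induction rule: proper_induct)
  case (Nil y)
  then show ?case by simp
next
  case (join p l a)
  let ?s = "(-1) ^ prism_degree p :: int" and ?B = "\<lambda>q. block_boundary L G star act q a []"
  have "frag_extend bd (right_mult a (bd p)) = frag_extend (\<lambda>q. bd (prism_join q a [])) (bd p)"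
    using frag_extend_compose[of bd "\<lambda>q. prism_join q a []"] by (simp add: right_mult_def comp_def)
  also have "\<dots> = frag_extend (\<lambda>q. right_mult a (bd q) + frag_cmul (- ?s) (?B q)) (bd p)"
  \<comment> \<open>Only prisms in the support of \<open>bd p\<close> matter; their degree is one
    below that of \<open>p\<close>, which flips the sign.\<close>
  proof (rule frag_extend_eq)
    fix q assume "q \<in> Poly_Mapping.keys (bd p)"
    then have "proper q" "(-1) ^ prism_degree q = - ?s"
      using keys_bd[OF join(1)] by (metis, metis minus_minus mult_minus1 power_Suc)
    then show "bd (prism_join q a []) = right_mult a (bd q) + frag_cmul (- ?s) (?B q)"
      using join by (simp add: bd_join last_boundary_def)
  qed
  also have "\<dots> = right_mult a (frag_extend bd (bd p)) + frag_cmul (- ?s) (frag_extend ?B (bd p))"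
  proof -
    have "frag_extend (\<lambda>q. right_mult a (bd q) + frag_cmul k (?B q)) c
      = right_mult a (frag_extend bd c) + frag_cmul k (frag_extend ?B c)" for c k
      by (induction c rule: frag_induct)
        (simp_all add: right_mult_def frag_extend_diff frag_cmul_diff_distrib2)
    then show ?thesis .
  qed
  \<comment> \<open>The induction hypothesis removes the first term; by
    \<open>bd_block_boundary\<close> the second cancels the boundary of the last-block
    summand.\<close>
  finally show ?case
    using join
    by (simp add: bd_join last_boundary_def frag_extend_add
        frag_extend_cmul bd_block_boundary right_mult_def flip: minus_frag_cmul)
qed

lemma bd_in_chains:
  assumes "c \<in> carrier (prismatic_chains L G Y n)"
  shows "frag_extend bd c \<in> carrier (prismatic_chains L G Y (n - 1))"
proof -
  have "Poly_Mapping.keys (bd p) \<subseteq> prisms L G Y (n - 1)" if "p \<in> prisms L G Y n" for p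
    using that keys_bd[of p] by (fastforce simp: prisms_eq)
  then show ?thesis
    using assms keys_frag_extend[of bd c] by (fastforce simp: prismatic_chains_def)
qed

lemma bd_bd_chain:
  assumes "c \<in> carrier (prismatic_chains L G Y n)"
  shows "frag_extend bd (frag_extend bd c) = 0"
proof -
  have "Poly_Mapping.keys c \<subseteq> Collect proper"
    using assms by (auto simp: prismatic_chains_def prisms_eq)
  then show ?thesis
    by (induction c rule: frag_induction) (simp_all add: bd_bd frag_extend_diff)
qed

end

theorem proposition4:
  fixes L :: "'l set"
    and G :: "'l \<Rightarrow> ('x, 'm) monoid_scheme"
    and star :: "'x \<Rightarrow> 'x \<Rightarrow> 'x"
    and Y :: "'y set"
    and act :: "'y \<Rightarrow> 'x \<Rightarrow> 'y"
  assumes "multiple_conjugation_quandle L G star"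
    and "mcq_set L G star Y act"
  shows "chain_complex (prismatic_chains L G Y) (prismatic_boundary L G star Y act)"
proof -
  interpret prismatic L G star Y act
    using assms by (simp add: prismatic_def)
  show ?thesis
    unfolding chain_complex_def
  proof (intro allI conjI ballI)
    fix n
    show "comm_group (prismatic_chains L G Y n)"
      by (simp add: prismatic_chains_def abelian_free_Abelian_group)
    show "prismatic_boundary L G star Y act n
        \<in> hom (prismatic_chains L G Y n) (prismatic_chains L G Y (n - 1))"
    proof (rule homI)
      fix c d assume cd: "c \<in> carrier (prismatic_chains L G Y n)" "d \<in> carrier (prismatic_chains L G Y n)"
      \<comment> \<open>Membership of the sum is needed to evaluate \<open>restrict\<close> on the
        product.\<close>
      then have "c + d \<in> carrier (prismatic_chains L G Y n)"
        using keys_add[of c d] by (auto simp: prismatic_chains_def)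
      with cd show "prismatic_boundary L G star Y act n (c \<otimes>\<^bsub>prismatic_chains L G Y n\<^esub> d)
        = prismatic_boundary L G star Y act n c
            \<otimes>\<^bsub>prismatic_chains L G Y (n - 1)\<^esub> prismatic_boundary L G star Y act n d"
        by (simp add: prismatic_boundary_def) (simp add: prismatic_chains_def frag_extend_add)
    qed (simp add: prismatic_boundary_def bd_in_chains)
    fix c assume "c \<in> carrier (prismatic_chains L G Y n)"
    then show "prismatic_boundary L G star Y act (n - 1) (prismatic_boundary L G star Y act n c)
        = \<one>\<^bsub>prismatic_chains L G Y (n - 2)\<^esub>"
      using bd_in_chains bd_bd_chain
      by (simp add: prismatic_boundary_def) (simp add: prismatic_chains_def)
  qed
qed

end
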